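(* Let $A\in\mathbf{RM}_7$ be such that $C(A)\supset E\cup(-E)$ for some ellipse $E$ different from $-E$. Then the foci of $E$ (and thus of $-E$ as well) are of opposite sign.
   Context: $\mathbf{RM}_7$ is the set of complex $7\times 7$ tridiagonal matrices $A=(a_{ij})$ with zero main diagonal and $a_{i,i+1}a_{i+1,i}=1$ for $i=1,\dots,6$ (reciprocal matrices). For a square matrix $A$, $\operatorname{Re}A=(A+A^* )/2$; the Kippenhahn polynomial of $A$ is $P_A(\lambda,\theta)=\det(\operatorname{Re}(e^{i\theta}A)-\lambda I)$, and the Kippenhahn curve $C(A)$ is the envelope of the family of lines $\{e^{-i\theta}(\lambda_j(\theta)+i\mathbb R):\theta\in(-\pi,\pi],\ j=1,\dots,7\}$, where $\lambda_j(\theta)$ are the roots of $P_A(\cdot,\theta)$. The foci of $C(A)$ are the eigenvalues of $A$, which are real ($2\cos\frac{k\pi}{8}$, $k=1,\dots,7$), so ellipses contained in $C(A)$ have real foci. $C(A)$ contains the ellipse with center $p\in\mathbb R$, foci $p\pm X$ ($X\ge 0$) and minor half-axis $c>0$ if and only if $P_A$ is divisible by $(\lambda-p\cos\theta)^2-(X^2\cos^2\theta+c^2)$ (as polynomials in $\lambda$ and $\cos\theta$). Ellipses here are genuine (non-degenerate): $c>0$. The curve $C(A)$ is symmetric about both coordinate axes, so $-E\subset C(A)$ whenever $E\subset C(A)$. *)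

theory Defs
  imports Complex_Main "Jordan_Normal_Form.Schur_Decomposition"
begin

definition reciprocal_mats :: "nat \<Rightarrow> complex mat set" where
  "reciprocal_mats n = {A \<in> carrier_mat n n.
     (\<forall>i<n. \<forall>j<n. i + 1 < j \<or> j + 1 < i \<longrightarrow> A $$ (i, j) = 0) \<and>
     (\<forall>i<n. A $$ (i, i) = 0) \<and>
     (\<forall>i. i + 1 < n \<longrightarrow> A $$ (i, i + 1) * A $$ (i + 1, i) = 1)}"

definition Re_mat :: "complex mat \<Rightarrow> complex mat" where
  "Re_mat A = (1 / 2) \<cdot>\<^sub>m (A + mat_adjoint A)"

definition kippenhahn_poly :: "complex mat \<Rightarrow> complex \<Rightarrow> real \<Rightarrow> complex" where
  "kippenhahn_poly A l \<theta> = det (Re_mat (cis \<theta> \<cdot>\<^sub>m A) - l \<cdot>\<^sub>m 1\<^sub>m (dim_row A))"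

definition rotated_line :: "real \<Rightarrow> real \<Rightarrow> complex set" where
  "rotated_line \<theta> l = {cis (- \<theta>) * (of_real l + \<i> * of_real s) | s. True}"

lemma mem_rotated_line_iff: "z \<in> rotated_line \<theta> l \<longleftrightarrow> Re (cis \<theta> * z) = l"
proof
  assume "z \<in> rotated_line \<theta> l"
  then obtain s where "z = cis (- \<theta>) * (of_real l + \<i> * of_real s)"
    unfolding rotated_line_def by blast
  then have "cis \<theta> * z = (cis \<theta> * cis (- \<theta>)) * (of_real l + \<i> * of_real s)"
    by (simp only: mult.assoc)
  also have "cis \<theta> * cis (- \<theta>) = 1" by (simp add: cis_mult)
  finally show "Re (cis \<theta> * z) = l" by simp
next
  assume "Re (cis \<theta> * z) = l"
  then have "cis \<theta> * z = of_real l + \<i> * of_real (Im (cis \<theta> * z))"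
    by (simp add: complex_eq_iff)
  then have "cis (- \<theta>) * (cis \<theta> * z)
      = cis (- \<theta>) * (of_real l + \<i> * of_real (Im (cis \<theta> * z)))"
    by (rule arg_cong)
  also have "cis (- \<theta>) * (cis \<theta> * z) = z"
    by (simp add: mult.assoc [symmetric] cis_mult)
  finally show "z \<in> rotated_line \<theta> l"
    unfolding rotated_line_def by blast
qed

text \<open>
  For a family of lines that at the angle \<open>\<theta>\<close> consists of the lines
  \<open>rotated_line \<theta> l\<close>, \<open>l \<in> S \<theta>\<close>, choose a local branch \<open>\<mu> t \<in> S t\<close>. The line of
  this branch at angle \<open>t\<close> has the equation \<open>Re (cis t * z) - \<mu> t = 0\<close>. The envelope
  consists of the points \<open>z\<close> satisfying this equation together with its derivative with
  respect to the parameter, i.e. \<open>z = cis (- \<theta>) * (\<mu> \<theta> - \<i> * \<mu>' \<theta>)\<close>.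
  The envelope is taken branch by branch, since at a multiple root the derivative of the
  product of the line equations over all branches vanishes on the entire line.
\<close>

definition line_envelope :: "(real \<Rightarrow> real set) \<Rightarrow> complex set" where
  "line_envelope S = {z. \<exists>\<theta> \<mu>. (\<forall>\<^sub>F t in nhds \<theta>. \<mu> t \<in> S t) \<and>
     z \<in> rotated_line \<theta> (\<mu> \<theta>) \<and>
     ((\<lambda>t. Re (cis t * z) - \<mu> t) has_real_derivative 0) (at \<theta>)}"

text \<open>
  The roots of the Kippenhahn polynomial are real, being eigenvalues of a Hermitian matrix.
  They can be arranged in real-analytic branches, so requiring the branch \<open>\<mu>\<close> above only to
  be differentiable at \<open>\<theta>\<close> gives the same points as requiring it to be analytic. The angle
  is not restricted to \<open>(-\<pi>, \<pi>]\<close> since everything is \<open>2 * \<pi>\<close>-periodic.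
\<close>

definition kippenhahn_curve :: "complex mat \<Rightarrow> complex set" where
  "kippenhahn_curve A = line_envelope (\<lambda>\<theta>. {l. kippenhahn_poly A (of_real l) \<theta> = 0})"

text \<open>
  The ellipse with foci \<open>f1\<close>, \<open>f2\<close> and major axis of length \<open>s\<close>; it is non-degenerate
  (has a positive minor half-axis) iff \<open>dist f1 f2 < s\<close>. Circles are included.
\<close>

definition ellipse :: "complex \<Rightarrow> complex \<Rightarrow> real \<Rightarrow> complex set" where
  "ellipse f1 f2 s = {z. dist z f1 + dist z f2 = s}"

end

theory Submission
  imports "HOL-Analysis.Equivalence_Lebesgue_Henstock_Integration" Defs
begin

text \<open>
  The Kippenhahn polynomial is \<open>- l * Q (l\<^sup>2)\<close> with a cubic \<open>Q\<close> whose coefficients are the matching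
  sums of \<open>(cos \<theta>)\<^sup>2 + a j\<close>, \<open>a j \<ge> 0\<close>. By a Sard-type argument almost every point of an ellipse
  contained in the envelope lies on a line of the family that is tangent to the ellipse there, so
  infinitely many tangent lines of the ellipse belong to the family. Tangency and the Kippenhahn
  equation are algebraic in \<open>cis (- 2 * \<theta>)\<close>; the pair of tangents of given direction is an irreducible
  quadratic, so all tangents belong to the family, and the limit \<open>cis (- 2 * \<theta>) \<rightarrow> 0\<close> shows that the
  foci are eigenvalues of the path, hence real. Let \<open>p\<close>, \<open>q\<close> be the foci, \<open>B\<close> the squared minor half-axis
  and \<open>t = (cos \<theta>)\<^sup>2\<close>. The squares of the two roots on parallel tangents are distinct roots of \<open>Q\<close> with
  product \<open>(p * q * t - B)\<^sup>2\<close>, which therefore divides \<open>- Q 0\<close>. This is a cubic polynomial in \<open>t\<close>, positive for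
  \<open>t > 0\<close>, so \<open>p * q\<close> is neither positive nor, for degree reasons, zero.
\<close>

section \<open>The Kippenhahn polynomial of a reciprocal matrix of order 7\<close>

text \<open>The recurrence of the leading principal minors of a tridiagonal matrix: \<open>d\<close>
  is the diagonal, \<open>x k\<close> the product of the two off-diagonal entries linking positions
  \<open>k\<close> and \<open>k + 1\<close>.\<close>

fun continuant :: "(nat \<Rightarrow> 'a :: comm_ring_1) \<Rightarrow> (nat \<Rightarrow> 'a) \<Rightarrow> nat \<Rightarrow> 'a" where
  "continuant d x 0 = 1"
| "continuant d x (Suc 0) = d 0"
| "continuant d x (Suc (Suc k)) = d (Suc k) * continuant d x (Suc k) - x k * continuant d x k"

text \<open>Laplace expansion along the last row leaves two terms. The minor of the subdiagonal
  entry has at most one nonzero entry in its last column, and expanding along that column gives the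
  recurrence.\<close>

lemma det_tridiagonal:
  fixes a :: "nat \<Rightarrow> nat \<Rightarrow> 'a :: comm_ring_1"
  assumes tri: "\<And>i j. i + 1 < j \<or> j + 1 < i \<Longrightarrow> i < n \<Longrightarrow> j < n \<Longrightarrow> a i j = 0"
  shows "det (mat n n (\<lambda>(i, j). a i j)) = continuant (\<lambda>i. a i i) (\<lambda>i. a i (i + 1) * a (i + 1) i) n"
  using tri
proof (induction n rule: less_induct)
  case (less n)
  let ?M = "\<lambda>k. mat k k (\<lambda>(i, j). a i j)"
  consider "n = 0" | "n = 1" | k where "n = Suc (Suc k)" by (metis One_nat_def not0_implies_Suc)
  then show ?case
  proof cases
    case 1
    then show ?thesis by simp
  next
    case 2
    then show ?thesis by (subst det_single) auto
  next
    case (3 k)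
    let ?D = "continuant (\<lambda>i. a i i) (\<lambda>i. a i (i + 1) * a (i + 1) i)"
    have IH: "det (?M (Suc k)) = ?D (Suc k)" "det (?M k) = ?D k"
      using less 3 by auto
    define B where "B = mat_delete (?M n) (Suc k) k"
    have B: "B \<in> carrier_mat (Suc k) (Suc k)" by (simp add: B_def 3 mat_delete_def)
    have "det (?M n) = (\<Sum>j<n. ?M n $$ (Suc k, j) * cofactor (?M n) (Suc k) j)"
      by (rule laplace_expansion_row) (auto simp: 3)
    also have "\<dots> = (\<Sum>j\<in>{k, Suc k}. ?M n $$ (Suc k, j) * cofactor (?M n) (Suc k) j)"
      by (rule sum.mono_neutral_right) (use less(2) 3 in auto)
    also have "\<dots> = a (Suc k) k * cofactor (?M n) (Suc k) k + a (Suc k) (Suc k) * cofactor (?M n) (Suc k) (Suc k)"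
      by (simp add: 3)
    also have "mat_delete (?M n) (Suc k) (Suc k) = ?M (Suc k)"
      by (rule eq_matI) (auto simp: mat_delete_def 3)
    then have "cofactor (?M n) (Suc k) (Suc k) = ?D (Suc k)"
      by (simp add: cofactor_def IH flip: mult_2)
    also have "cofactor (?M n) (Suc k) k = - det B"
      by (simp add: cofactor_def B_def)
    also have "det B = (\<Sum>i<Suc k. B $$ (i, k) * cofactor B i k)"
      by (rule laplace_expansion_column[OF B]) simp
    also have "\<dots> = (\<Sum>i\<in>{k}. B $$ (i, k) * cofactor B i k)"
      by (rule sum.mono_neutral_right) (use less(2) 3 in \<open>auto simp: B_def mat_delete_def\<close>)
    also have "\<dots> = a k (Suc k) * cofactor B k k"
      by (simp add: B_def mat_delete_def 3)
    also have "mat_delete B k k = ?M k"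
      by (rule eq_matI) (auto simp: B_def mat_delete_def 3)
    then have "cofactor B k k = ?D k"
      by (simp add: cofactor_def IH flip: mult_2)
    finally show ?thesis by (simp add: 3 algebra_simps)
  qed
qed

text \<open>The matching polynomial of the path on 7 vertices with edge weights \<open>x 0\<close>,
  ..., \<open>x 5\<close>, divided by its trivial factor \<open>l\<close> and written in
  \<open>y = l\<^sup>2\<close>: a product of weights occurs when no two of its edges share a
  vertex.\<close>

definition rm7_sq :: "'a :: comm_ring_1 \<Rightarrow> (nat \<Rightarrow> 'a) \<Rightarrow> 'a" where
  "rm7_sq y x = y ^ 3 - (x 0 + x 1 + x 2 + x 3 + x 4 + x 5) * y ^ 2
    + (x 0 * (x 2 + x 3 + x 4 + x 5) + x 1 * (x 3 + x 4 + x 5) + x 2 * (x 4 + x 5) + x 3 * x 5) * y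
    - (x 0 * x 2 * x 4 + x 0 * x 2 * x 5 + x 0 * x 3 * x 5 + x 1 * x 3 * x 5)"

lemma continuant_7:
  fixes l :: "'a :: comm_ring_1"
  shows "continuant (\<lambda>_. - l) x 7 = - l * rm7_sq (l\<^sup>2) x"
proof -
  let ?c = "continuant (\<lambda>_. - l) x"
  have step: "?c n = - l * ?c m - x k * ?c k" if "n = k + 2" "m = k + 1" for n m k
    using that by simp
  have c1: "?c 1 = - l" by simp
  have c2: "?c 2 = l * l - x 0"
    by (simp add: numeral_2_eq_2)
  have "?c 3 = - l * ?c 2 - x 1 * ?c 1" by (rule step) simp_all
  then have c3: "?c 3 = - l * (l * l - x 0 - x 1)"
    unfolding c1 c2 by (simp add: algebra_simps)
  have "?c 4 = - l * ?c 3 - x 2 * ?c 2" by (rule step) simp_all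
  then have c4: "?c 4 = l * l * (l * l) - (x 0 + x 1 + x 2) * (l * l) + x 0 * x 2"
    unfolding c2 c3 by (simp add: algebra_simps)
  have "?c 5 = - l * ?c 4 - x 3 * ?c 3" by (rule step) simp_all
  then have c5: "?c 5 = - l * (l * l * (l * l) - (x 0 + x 1 + x 2 + x 3) * (l * l) + x 0 * x 2 + x 0 * x 3 + x 1 * x 3)"
    unfolding c3 c4 by (simp add: algebra_simps)
  have "?c 6 = - l * ?c 5 - x 4 * ?c 4" by (rule step) simp_all
  then have c6: "?c 6 = l * l * (l * l) * (l * l) - (x 0 + x 1 + x 2 + x 3 + x 4) * (l * l * (l * l))
      + (x 0 * (x 2 + x 3 + x 4) + x 1 * (x 3 + x 4) + x 2 * x 4) * (l * l) - x 0 * x 2 * x 4"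
    unfolding c4 c5 by (simp add: algebra_simps)
  have "?c 7 = - l * ?c 6 - x 5 * ?c 5" by (rule step) simp_all
  then show ?thesis
    unfolding c5 c6 rm7_sq_def power2_eq_square power3_eq_cube by (simp add: algebra_simps)
qed

lemma mat_adjoint_carrier: "A \<in> carrier_mat n n \<Longrightarrow> mat_adjoint A \<in> carrier_mat n n"
  unfolding mat_adjoint_def by auto

lemma mat_adjoint_index:
  "A \<in> carrier_mat n n \<Longrightarrow> i < n \<Longrightarrow> j < n \<Longrightarrow> mat_adjoint A $$ (i, j) = cnj (A $$ (j, i))"
  unfolding mat_adjoint_def by (auto simp: mat_of_rows_index conjugate_complex_def)

text \<open>For a reciprocal matrix \<open>1 / cmod (A $$ (j, j + 1))\<close> is the modulus of the
  entry below the diagonal.\<close>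

definition coupling :: "complex mat \<Rightarrow> nat \<Rightarrow> real" where
  "coupling A j = ((cmod (A $$ (j, j + 1)) - 1 / cmod (A $$ (j, j + 1))) / 2)\<^sup>2"

lemma coupling_nonneg: "coupling A j \<ge> 0"
  by (simp add: coupling_def)

text \<open>In the expansion \<open>a * a'\<close> contributes only
  \<open>2 * cos (2 * \<theta>)\<close>, while the remaining terms depend on the moduli alone, which
  are reciprocal; the double angle formula then completes the square.\<close>

lemma offdiag_product:
  assumes "a * a' = 1"
  shows "(cis \<theta> * a + cnj (cis \<theta> * a')) / 2 * ((cis \<theta> * a' + cnj (cis \<theta> * a)) / 2)
    = of_real ((cos \<theta>)\<^sup>2 + ((cmod a - 1 / cmod a) / 2)\<^sup>2)"
proof -
  let ?u = "cis \<theta>"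
  have "a \<noteq> 0" using assms by auto
  then have a: "a \<noteq> 0" "a' = 1 / a" using assms by (auto simp: divide_simps mult.commute)
  define r where "r = cmod a"
  have r: "r > 0" using a by (simp add: r_def)
  have uu: "?u * cnj ?u = 1" by (simp add: cis_cnj cis_mult)
  have aa: "a * cnj a = of_real (r\<^sup>2)" by (metis complex_norm_square r_def)
  have id: "(p + cnj q) / 2 * ((q + cnj p) / 2) = (p * q + cnj (p * q) + p * cnj p + q * cnj q) / 4" for p q
    by (simp add: algebra_simps)
  have "?u * a * (?u * a') = ?u * ?u * (a * a')" by (simp only: ac_simps)
  then have 1: "?u * a * (?u * a') = cis (2 * \<theta>)" by (simp add: assms cis_mult)
  have "?u * a * cnj (?u * a) = (?u * cnj ?u) * (a * cnj a)" by (simp only: complex_cnj_mult ac_simps)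
  then have 2: "?u * a * cnj (?u * a) = of_real (r\<^sup>2)" by (simp only: uu aa mult_1)
  have "?u * a' * cnj (?u * a') = (?u * cnj ?u) / (a * cnj a)" by (simp add: a)
  then have 3: "?u * a' * cnj (?u * a') = of_real (1 / r\<^sup>2)" by (simp only: uu aa of_real_divide of_real_1)
  have "((r - 1 / r) / 2)\<^sup>2 = (r\<^sup>2 + 1 / r\<^sup>2 - 2) / 4"
    using r by (simp add: power2_eq_square field_simps)
  then have "(cos \<theta>)\<^sup>2 + ((r - 1 / r) / 2)\<^sup>2 = (2 * cos (2 * \<theta>) + r\<^sup>2 + 1 / r\<^sup>2) / 4"
    by (simp add: cos_double_cos)
  then show ?thesis
    unfolding id 1 2 3 r_def[symmetric] by (simp add: complex_eq_iff)
qed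

text \<open>The shifted Hermitian part is tridiagonal with constant diagonal \<open>- l\<close>, so
  \<open>A\<close> enters only through its couplings and \<open>\<theta>\<close> only through
  \<open>(cos \<theta>)\<^sup>2\<close>.\<close>

lemma kippenhahn_poly_rm7:
  assumes "A \<in> reciprocal_mats 7"
  shows "kippenhahn_poly A l \<theta> = - l * rm7_sq (l\<^sup>2) (\<lambda>j. of_real ((cos \<theta>)\<^sup>2 + coupling A j))"
proof -
  have A: "A \<in> carrier_mat 7 7"
    and tri: "\<And>i j. i < 7 \<Longrightarrow> j < 7 \<Longrightarrow> i + 1 < j \<or> j + 1 < i \<Longrightarrow> A $$ (i, j) = 0"
    and diag: "\<And>i. i < 7 \<Longrightarrow> A $$ (i, i) = 0"
    and rec: "\<And>i. i + 1 < 7 \<Longrightarrow> A $$ (i, i + 1) * A $$ (i + 1, i) = 1"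
    using assms unfolding reciprocal_mats_def by auto
  define a where "a i j = (cis \<theta> * A $$ (i, j) + cnj (cis \<theta> * A $$ (j, i))) / 2 - (if i = j then l else 0)" for i j
  let ?B = "cis \<theta> \<cdot>\<^sub>m A"
  have B: "?B \<in> carrier_mat 7 7" using A by simp
  have "Re_mat ?B - l \<cdot>\<^sub>m 1\<^sub>m (dim_row A) = mat 7 7 (\<lambda>(i, j). a i j)"
  proof (rule eq_matI)
    fix i j assume "i < dim_row (mat 7 7 (\<lambda>(i, j). a i j))" "j < dim_col (mat 7 7 (\<lambda>(i, j). a i j))"
    then have ij: "i < 7" "j < 7" by auto
    show "(Re_mat ?B - l \<cdot>\<^sub>m 1\<^sub>m (dim_row A)) $$ (i, j) = mat 7 7 (\<lambda>(i, j). a i j) $$ (i, j)"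
      using ij A mat_adjoint_carrier[OF B] mat_adjoint_index[OF B ij]
      by (auto simp: Re_mat_def a_def field_simps)
  qed (use A mat_adjoint_carrier[OF B] in \<open>auto simp: Re_mat_def\<close>)
  then have "kippenhahn_poly A l \<theta> = continuant (\<lambda>i. a i i) (\<lambda>i. a i (i + 1) * a (i + 1) i) 7"
    unfolding kippenhahn_poly_def by (simp, subst det_tridiagonal) (auto simp: a_def tri)
  also have "\<dots> = continuant (\<lambda>_. - l) (\<lambda>j. of_real ((cos \<theta>)\<^sup>2 + coupling A j)) 7"
  proof -
    have d: "a i i = - l" if "i < 7" for i using that by (simp add: a_def diag)
    have o: "a i (i + 1) * a (i + 1) i = of_real ((cos \<theta>)\<^sup>2 + coupling A i)" if "i + 1 < 7" for i
      using offdiag_product[OF rec[OF that], of \<theta>] by (simp add: a_def coupling_def)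
    \<comment> \<open>The arguments agree only inside the index range of the matrix, so the
      continuants are compared by induction up to order 7.\<close>
    have cong: "k \<le> 7 \<Longrightarrow> continuant (\<lambda>i. a i i) (\<lambda>i. a i (i + 1) * a (i + 1) i) k
       = continuant (\<lambda>_. - l) (\<lambda>j. of_real ((cos \<theta>)\<^sup>2 + coupling A j)) k" for k
      by (induction k rule: induct_nat_012) (use d o in auto)
    then show ?thesis by blast
  qed
  finally show ?thesis by (simp add: continuant_7)
qed

section \<open>Negligible sets of transversal contacts\<close>

lemma grid_point_near:
  fixes q w \<theta> :: real
  assumes "w > 0" "n > 0" "\<theta> \<in> {q..q + w}"
  shows "\<exists>k<n. \<bar>q + of_nat k * (w / of_nat n) - \<theta>\<bar> \<le> w / of_nat n \<and>
    q + of_nat k * (w / of_nat n) \<in> {q..q + w}"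
proof -
  define y where "y = (\<theta> - q) * n / w"
  have y: "0 \<le> y" "y \<le> n"
  proof -
    show "0 \<le> y" using assms by (simp add: y_def)
    have "(\<theta> - q) * n \<le> w * n" using assms by (intro mult_right_mono) auto
    then show "y \<le> n" using assms by (simp add: y_def divide_simps mult.commute)
  qed
  \<comment> \<open>The grid omits the right endpoint, so \<open>y = n\<close> is served by
    \<open>k = n - 1\<close>; otherwise the floor of \<open>y\<close> works.\<close>
  obtain k :: nat where k: "k < n" "\<bar>k - y\<bar> \<le> 1"
  proof (cases "y = n")
    case True
    then show ?thesis using that[of "n - 1"] assms(2) by auto
  next
    case False
    then have "nat \<lfloor>y\<rfloor> < n" using y by linarith
    moreover have "\<bar>nat \<lfloor>y\<rfloor> - y\<bar> \<le> 1" using y by linarith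
    ultimately show ?thesis using that by blast
  qed
  have "q + k * (w / n) - \<theta> = (k - y) * (w / n)" using assms by (simp add: y_def field_simps)
  then have "\<bar>q + k * (w / n) - \<theta>\<bar> = \<bar>k - y\<bar> * (w / n)" using assms by (simp add: abs_mult)
  also have "\<dots> \<le> 1 * (w / n)" by (rule mult_right_mono) (use k assms in auto)
  finally have 1: "\<bar>q + k * (w / n) - \<theta>\<bar> \<le> w / n" by simp
  have "real k * w \<le> real n * w" using k assms by (intro mult_right_mono) auto
  then have "k * (w / n) \<le> w" "0 \<le> k * (w / n)" using assms by (auto simp: field_simps)
  then show ?thesis using 1 k by (auto intro!: exI[of _ k])
qed

text \<open>At each of \<open>n\<close> equidistant times the at most \<open>M\<close> values in \<open>R t\<close> capture the points of \<open>B\<close> up to an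
  error \<open>o (1 / n)\<close>, so \<open>B\<close> is eventually covered by \<open>n * M\<close> intervals of total length \<open>o 1\<close>. No regularity
  of \<open>R\<close> is needed, in particular not at multiple roots.\<close>

lemma negligible_contacts_cell:
  fixes g :: "real \<Rightarrow> real \<Rightarrow> real" and R :: "real \<Rightarrow> real set"
  assumes w: "w > 0" and \<kappa>: "\<kappa> > 0"
    and R: "\<And>t. finite (R t)" "\<And>t. card (R t) \<le> M"
    and expand: "\<And>t \<phi> \<phi>'. t \<in> {q..q + w} \<Longrightarrow> \<phi> \<in> I \<Longrightarrow> \<phi>' \<in> I \<Longrightarrow> \<kappa> * \<bar>\<phi> - \<phi>'\<bar> \<le> \<bar>g t \<phi> - g t \<phi>'\<bar>"
    and BI: "B \<subseteq> I"
    and B: "\<And>\<phi>. \<phi> \<in> B \<Longrightarrow> \<exists>\<theta>\<in>{q..q + w}.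
      \<forall>\<epsilon>>0. \<exists>\<delta>>0. \<forall>t. \<bar>t - \<theta>\<bar> < \<delta> \<longrightarrow> (\<exists>l\<in>R t. \<bar>g t \<phi> - l\<bar> \<le> \<epsilon> * \<bar>t - \<theta>\<bar>)"
  shows "negligible B"
  unfolding negligible_outer_le
proof (intro allI impI)
  fix e :: real assume e: "e > 0"
  define m where "m = real M + 1"
  have m: "m > 0" "M \<le> m" by (auto simp: m_def)
  \<comment> \<open>Chosen so that \<open>n * m\<close> intervals of length
    \<open>2 * \<rho> n\<close> have total length exactly \<open>e\<close>, for every
    \<open>n > 0\<close>. Taking \<open>m\<close> as \<open>M + 1\<close> keeps the divisor
    positive.\<close>
  define \<epsilon> where "\<epsilon> = e * \<kappa> / (4 * m * w)"
  have \<epsilon>: "\<epsilon> > 0" using e \<kappa> w m by (simp add: \<epsilon>_def)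
  define t where "t n k = q + of_nat k * (w / of_nat n)" for n k :: nat
  \<comment> \<open>Two points near the same \<open>l\<close> have values of \<open>g\<close> at
    most \<open>2 * \<epsilon> * w / n\<close> apart; dividing by \<open>\<kappa>\<close> bounds
    their distance.\<close>
  define \<rho> where "\<rho> n = 2 * \<epsilon> * w / (n * \<kappa>)" for n :: nat
  define near where "near n k l \<phi> \<longleftrightarrow> \<phi> \<in> I \<and> \<bar>g (t n k) \<phi> - l\<bar> \<le> \<epsilon> * (w / n)" for n k :: nat and l \<phi>
  \<comment> \<open>One representative per value \<open>l\<close>; the interval around it catches
    all points near \<open>l\<close>. If there is none, the arbitrary value merely adds an
    interval.\<close>
  define c where "c n k l = (SOME \<phi>. near n k l \<phi>)" for n k l
  define U where "U n = (\<Union>k<n. \<Union>l\<in>R (t n k). cbox (c n k l - \<rho> n) (c n k l + \<rho> n))" for n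
  have U_meas: "U n \<in> lmeasurable" for n
    unfolding U_def using R by (intro fmeasurable.finite_UN) auto
  have U_le: "measure lebesgue (U n) \<le> e" if n: "n > 0" for n
  proof -
    have \<rho>: "\<rho> n > 0" using \<epsilon> w \<kappa> n by (simp add: \<rho>_def)
    have "measure lebesgue (\<Union>l\<in>R (t n k). cbox (c n k l - \<rho> n) (c n k l + \<rho> n)) \<le> M * (2 * \<rho> n)" for k
    proof -
      have "measure lebesgue (\<Union>l\<in>R (t n k). cbox (c n k l - \<rho> n) (c n k l + \<rho> n))
        \<le> (\<Sum>l\<in>R (t n k). measure lebesgue (cbox (c n k l - \<rho> n) (c n k l + \<rho> n)))"
        using R by (intro measure_UNION_le) auto
      also have "\<dots> = card (R (t n k)) * (2 * \<rho> n)" using \<rho> by simp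
      also have "\<dots> \<le> M * (2 * \<rho> n)" using R \<rho> by (intro mult_right_mono) auto
      finally show ?thesis .
    qed
    then have "(\<Sum>k<n. measure lebesgue (\<Union>l\<in>R (t n k). cbox (c n k l - \<rho> n) (c n k l + \<rho> n)))
      \<le> (\<Sum>k<n. M * (2 * \<rho> n))" by (intro sum_mono)
    moreover have "measure lebesgue (U n)
      \<le> (\<Sum>k<n. measure lebesgue (\<Union>l\<in>R (t n k). cbox (c n k l - \<rho> n) (c n k l + \<rho> n)))"
      unfolding U_def using R by (intro measure_UNION_le fmeasurableD fmeasurable.finite_UN) auto
    moreover have "(\<Sum>k<n. M * (2 * \<rho> n)) = M * (n * (2 * \<rho> n))" by simp
    moreover have "\<dots> \<le> m * (n * (2 * \<rho> n))" using \<rho> m by (intro mult_right_mono) auto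
    moreover have "\<dots> = e"
    proof -
      have "n * (2 * \<rho> n) = 4 * (\<epsilon> * w / \<kappa>)" using n by (simp add: \<rho>_def)
      also have "\<epsilon> * w / \<kappa> = e / (4 * m)" using w \<kappa> by (simp add: \<epsilon>_def)
      finally show ?thesis using m by simp
    qed
    ultimately show ?thesis by linarith
  qed
  \<comment> \<open>How large \<open>n\<close> must be depends on the point, so \<open>B\<close> is
    covered only by the limit inferior of the sets \<open>U n\<close>. It is the increasing union of
    the \<open>L m\<close>, each of which lies in \<open>U (Suc m)\<close>.\<close>
  define L where "L m = (\<Inter>n\<in>{Suc m..}. U n)" for m
  have L_meas: "L m \<in> lmeasurable" for m
    unfolding L_def using U_meas by (intro fmeasurable_INT[of _ "Suc m"]) (auto intro: fmeasurableD)
  have L_le: "measure lebesgue (L m) \<le> e" for m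
  proof -
    have "measure lebesgue (L m) \<le> measure lebesgue (U (Suc m))"
      using U_meas L_meas by (intro measure_mono_fmeasurable) (auto simp: L_def intro: fmeasurableD)
    then show ?thesis using U_le[of "Suc m"] by simp
  qed
  have L_mono: "L m \<subseteq> L (Suc m)" for m by (auto simp: L_def)
  have "B \<subseteq> (\<Union>m. L m)"
  proof
    fix \<phi> assume \<phi>: "\<phi> \<in> B"
    from B[OF this] obtain \<theta> where \<theta>: "\<theta> \<in> {q..q + w}"
      and "\<forall>\<epsilon>>0. \<exists>\<delta>>0. \<forall>t. \<bar>t - \<theta>\<bar> < \<delta> \<longrightarrow> (\<exists>l\<in>R t. \<bar>g t \<phi> - l\<bar> \<le> \<epsilon> * \<bar>t - \<theta>\<bar>)" by blast
    then obtain \<delta> where \<delta>: "\<delta> > 0"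
      and near_l: "\<And>t. \<bar>t - \<theta>\<bar> < \<delta> \<Longrightarrow> \<exists>l\<in>R t. \<bar>g t \<phi> - l\<bar> \<le> \<epsilon> * \<bar>t - \<theta>\<bar>"
      using \<epsilon> by meson
    obtain m :: nat where m: "w / \<delta> < m" using reals_Archimedean2 by blast
    have "\<phi> \<in> U n" if "n \<ge> Suc m" for n
    proof -
      have n: "n > 0" "real n > m" using that by auto
      have "w / n < \<delta>" 
      proof -
        have "w < m * \<delta>" using m \<delta> by (simp add: pos_divide_less_eq)
        also have "\<dots> \<le> n * \<delta>" using n \<delta> by (intro mult_right_mono) auto
        finally show ?thesis using n by (simp add: pos_divide_less_eq mult.commute)
      qed
      obtain k where k: "k < n" "\<bar>t n k - \<theta>\<bar> \<le> w / n" "t n k \<in> {q..q + w}"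
        using grid_point_near[OF w n(1) \<theta>] unfolding t_def by blast
      then have "\<bar>t n k - \<theta>\<bar> < \<delta>" using \<open>w / n < \<delta>\<close> by linarith
      then obtain l where l: "l \<in> R (t n k)" "\<bar>g (t n k) \<phi> - l\<bar> \<le> \<epsilon> * \<bar>t n k - \<theta>\<bar>"
        using near_l by blast
      have "\<epsilon> * \<bar>t n k - \<theta>\<bar> \<le> \<epsilon> * (w / n)" using k \<epsilon> by (intro mult_left_mono) auto
      then have nr: "near n k l \<phi>" using l \<phi> BI by (auto simp: near_def)
      then have nc: "near n k l (c n k l)" unfolding c_def by (rule someI)
      have "\<kappa> * \<bar>\<phi> - c n k l\<bar> \<le> \<bar>g (t n k) \<phi> - g (t n k) (c n k l)\<bar>"
        using expand k nr nc by (auto simp: near_def)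
      also have "\<dots> \<le> 2 * (\<epsilon> * (w / n))" using nr nc unfolding near_def by linarith
      finally have "\<bar>\<phi> - c n k l\<bar> \<le> \<rho> n" using \<kappa> n by (simp add: \<rho>_def field_simps)
      then have "\<phi> \<in> cbox (c n k l - \<rho> n) (c n k l + \<rho> n)" by auto
      then show ?thesis unfolding U_def using k l by blast
    qed
    then show "\<phi> \<in> (\<Union>m. L m)" unfolding L_def by blast
  qed
  moreover have "(\<Union>m. L m) \<in> lmeasurable"
    by (rule measurable_nested_Union[where B = e]) (fact L_meas L_le L_mono)+
  moreover have "measure lebesgue (\<Union>m. L m) \<le> e"
  proof (rule LIMSEQ_le_const2)
    show "(\<lambda>m. measure lebesgue (L m)) \<longlonglongrightarrow> measure lebesgue (\<Union>m. L m)"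
      by (rule measure_nested_Union[where B = e]) (fact L_meas L_le L_mono)+
  qed (use L_le in auto)
  ultimately show "\<exists>T. B \<subseteq> T \<and> T \<in> lmeasurable \<and> measure lebesgue T \<le> e" by blast
qed

text \<open>Continuity of \<open>g'\<close> puts every transversal contact into one of countably
  many product cells on which \<open>\<bar>g' t \<phi>\<bar> \<ge> 1 / N\<close>. There the mean
  value theorem makes \<open>g t\<close> expanding, so that \<open>negligible_contacts_cell\<close>
  applies.\<close>

lemma negligible_transversal_contacts:
  fixes g g' :: "real \<Rightarrow> real \<Rightarrow> real" and R :: "real \<Rightarrow> real set"
  assumes R: "\<And>t. finite (R t)" "\<And>t. card (R t) \<le> M"
    and deriv: "\<And>t \<phi>. (g t has_real_derivative g' t \<phi>) (at \<phi>)"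
    and cont: "continuous_on UNIV (\<lambda>(t, \<phi>). g' t \<phi>)"
  shows "negligible {\<phi>. \<exists>\<theta> \<mu>. (\<forall>\<^sub>F t in nhds \<theta>. \<mu> t \<in> R t) \<and> g \<theta> \<phi> = \<mu> \<theta> \<and>
    ((\<lambda>t. g t \<phi> - \<mu> t) has_real_derivative 0) (at \<theta>) \<and> g' \<theta> \<phi> \<noteq> 0}" (is "negligible ?S")
proof -
  define contact where "contact \<theta> \<phi> \<longleftrightarrow> (\<exists>\<mu>. (\<forall>\<^sub>F t in nhds \<theta>. \<mu> t \<in> R t) \<and> g \<theta> \<phi> = \<mu> \<theta> \<and>
    ((\<lambda>t. g t \<phi> - \<mu> t) has_real_derivative 0) (at \<theta>))" for \<theta> \<phi>
  \<comment> \<open>Since the difference and its derivative vanish at \<open>\<theta>\<close>, the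
    error is of smaller order than \<open>\<bar>t - \<theta>\<bar>\<close>; from here on the branch
    \<open>\<mu>\<close> is forgotten and only the sets \<open>R t\<close> matter.\<close>
  have contactD: "\<exists>\<delta>>0. \<forall>t. \<bar>t - \<theta>\<bar> < \<delta> \<longrightarrow> (\<exists>l\<in>R t. \<bar>g t \<phi> - l\<bar> \<le> \<epsilon> * \<bar>t - \<theta>\<bar>)"
    if c: "contact \<theta> \<phi>" and \<epsilon>: "\<epsilon> > 0" for \<theta> \<phi> \<epsilon>
  proof -
    from c obtain \<mu> where \<mu>: "\<forall>\<^sub>F t in nhds \<theta>. \<mu> t \<in> R t" "g \<theta> \<phi> = \<mu> \<theta>"
      and d: "((\<lambda>t. g t \<phi> - \<mu> t) has_real_derivative 0) (at \<theta>)" unfolding contact_def by blast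
    from \<mu>(1) obtain \<delta>1 where 1: "\<delta>1 > 0" "\<And>t. \<bar>t - \<theta>\<bar> < \<delta>1 \<Longrightarrow> \<mu> t \<in> R t"
      by (auto simp: eventually_nhds_metric dist_real_def)
    from d have "((\<lambda>t. g t \<phi> - \<mu> t) has_derivative ((*) 0)) (at \<theta>)"
      unfolding has_field_derivative_def .
    then obtain \<delta>2 where 2: "\<delta>2 > 0" "\<And>t. \<bar>t - \<theta>\<bar> < \<delta>2 \<Longrightarrow> \<bar>g t \<phi> - \<mu> t\<bar> \<le> \<epsilon> * \<bar>t - \<theta>\<bar>"
      unfolding has_derivative_at_alt using \<epsilon> \<mu>(2) by auto
    show ?thesis using 1 2 by (intro exI[of _ "min \<delta>1 \<delta>2"]) auto
  qed
  define cell :: "nat \<Rightarrow> int \<Rightarrow> real set" where "cell N i = {i / N..i / N + 1 / N}" for N i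
  have cellI: "x \<in> cell N \<lfloor>x * N\<rfloor>" if "N > 0" for x N
    using that of_int_floor_le[of "x * N"] floor_correct[of "x * N"] unfolding cell_def
    by (auto simp: field_simps simp flip: add_divide_distrib)
  have cellD: "\<bar>x - y\<bar> \<le> 1 / N" if "x \<in> cell N i" "y \<in> cell N i" for x y N i
    using that unfolding cell_def by auto
  define good where "good N i j \<longleftrightarrow> N > 0 \<and> (\<forall>t\<in>cell N j. \<forall>\<phi>\<in>cell N i. \<bar>g' t \<phi>\<bar> \<ge> 1 / N)" for N i j
  define B where "B N i j = (if good N i j then {\<phi> \<in> cell N i. \<exists>\<theta>\<in>cell N j. contact \<theta> \<phi>} else {})" for N i j
  have neg: "negligible (B N i j)" for N i j
  proof (cases "good N i j")
    case True
    then have N: "N > 0" by (simp add: good_def)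
    have "negligible {\<phi> \<in> cell N i. \<exists>\<theta>\<in>cell N j. contact \<theta> \<phi>}"
    proof (rule negligible_contacts_cell[where w = "1 / N" and \<kappa> = "1 / N" and q = "j / N"
          and I = "cell N i" and R = R and M = M and g = g])
      fix t \<phi> \<phi>' assume t: "t \<in> {j / N..j / N + 1 / N}" and \<phi>: "\<phi> \<in> cell N i" "\<phi>' \<in> cell N i"
      have *: "1 / N * \<bar>x - y\<bar> \<le> \<bar>g t x - g t y\<bar>" if xy: "x < y" "x \<in> cell N i" "y \<in> cell N i" for x y
      proof -
        obtain z where z: "x < z" "z < y" "g t y - g t x = (y - x) * g' t z"
          using MVT2[of x y "g t" "g' t"] xy deriv by blast
        then have "z \<in> cell N i" using xy unfolding cell_def by auto
        then have "1 / N \<le> \<bar>g' t z\<bar>" using True t unfolding good_def cell_def by blast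
        then have "1 / N * \<bar>y - x\<bar> \<le> \<bar>g' t z\<bar> * \<bar>y - x\<bar>" by (intro mult_right_mono) auto
        also have "\<dots> = \<bar>g t y - g t x\<bar>" using z by (simp add: abs_mult)
        finally show ?thesis by (simp add: abs_minus_commute)
      qed
      show "1 / N * \<bar>\<phi> - \<phi>'\<bar> \<le> \<bar>g t \<phi> - g t \<phi>'\<bar>"
        using *[of \<phi> \<phi>'] *[of \<phi>' \<phi>] \<phi> by (cases \<phi> \<phi>' rule: linorder_cases) (auto simp: abs_minus_commute)
    next
      fix \<phi> assume "\<phi> \<in> {\<phi> \<in> cell N i. \<exists>\<theta>\<in>cell N j. contact \<theta> \<phi>}"
      then obtain \<theta> where "\<theta> \<in> cell N j" "contact \<theta> \<phi>" by blast
      then show "\<exists>\<theta>\<in>{j / N..j / N + 1 / N}. \<forall>\<epsilon>>0. \<exists>\<delta>>0. \<forall>t. \<bar>t - \<theta>\<bar> < \<delta> \<longrightarrow> (\<exists>l\<in>R t. \<bar>g t \<phi> - l\<bar> \<le> \<epsilon> * \<bar>t - \<theta>\<bar>)"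
        unfolding cell_def using contactD by blast
    qed (use N R in auto)
    then show ?thesis using True by (simp add: B_def)
  qed (simp add: B_def)
  have "?S \<subseteq> (\<Union>(N, i, j). B N i j)"
  proof
    fix \<phi> assume "\<phi> \<in> ?S"
    then obtain \<theta> where \<theta>: "contact \<theta> \<phi>" "g' \<theta> \<phi> \<noteq> 0" unfolding contact_def by blast
    have "continuous (at (\<theta>, \<phi>)) (\<lambda>(t, \<phi>). g' t \<phi>)"
      using cont by (simp add: continuous_on_eq_continuous_at)
    moreover have "\<bar>g' \<theta> \<phi>\<bar> / 2 > 0" using \<theta> by simp
    ultimately obtain d where d: "d > 0"
      and "\<forall>p. dist p (\<theta>, \<phi>) < d \<longrightarrow> dist ((\<lambda>(t, \<phi>). g' t \<phi>) p) (g' \<theta> \<phi>) < \<bar>g' \<theta> \<phi>\<bar> / 2"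
      unfolding continuous_at_eps_delta by (metis case_prod_conv)
    then have d': "\<And>t x. dist (t, x) (\<theta>, \<phi>) < d \<Longrightarrow> \<bar>g' t x - g' \<theta> \<phi>\<bar> < \<bar>g' \<theta> \<phi>\<bar> / 2"
      by (metis case_prod_conv dist_real_def)
    \<comment> \<open>The first bound keeps the product cell within distance \<open>d\<close>, the
      second makes \<open>1 / N\<close> at most half of
      \<open>\<bar>g' \<theta> \<phi>\<bar>\<close>.\<close>
    obtain N :: nat where N: "N > max (2 / d) (2 / \<bar>g' \<theta> \<phi>\<bar>)" using reals_Archimedean2 by blast
    have N0: "N > 0" using N d by (metis gr0I less_max_iff_disj divide_pos_pos max.strict_coboundedI1 not_less_iff_gr_or_eq of_nat_0 order.strict_trans zero_less_numeral)
    have N1: "2 * (1 / N) < d" "1 / N \<le> \<bar>g' \<theta> \<phi>\<bar> / 2"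
      using N N0 d \<theta> by (auto simp: field_simps)
    let ?i = "\<lfloor>\<phi> * N\<rfloor>" and ?j = "\<lfloor>\<theta> * N\<rfloor>"
    have "good N ?i ?j"
      unfolding good_def
    proof (intro conjI ballI)
      fix t x assume tx: "t \<in> cell N ?j" "x \<in> cell N ?i"
      have "dist (t, x) (\<theta>, \<phi>) \<le> \<bar>t - \<theta>\<bar> + \<bar>x - \<phi>\<bar>"
        by (simp add: dist_prod_def dist_real_def sqrt_sum_squares_le_sum_abs)
      also have "\<dots> < d" using cellD[OF tx(1) cellI[OF N0]] cellD[OF tx(2) cellI[OF N0]] N1 by linarith
      finally show "1 / N \<le> \<bar>g' t x\<bar>" using d' N1 by (smt (verit) field_sum_of_halves)
    qed (use N0 in auto)
    then have "\<phi> \<in> B N ?i ?j" using \<theta> cellI[OF N0] by (auto simp: B_def)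
    then show "\<phi> \<in> (\<Union>(N, i, j). B N i j)" by blast
  qed
  moreover have "negligible (\<Union>(N, i, j). B N i j)"
    by (rule negligible_countable_Union) (use neg in auto)
  ultimately show ?thesis using negligible_subset by blast
qed

section \<open>Polynomial identities on the curve of tangent lines\<close>

lemma rm7_sq_homogeneous: "rm7_sq (c * y) (\<lambda>j. c * x j) = c ^ 3 * rm7_sq y x"
  unfolding rm7_sq_def power2_eq_square power3_eq_cube by (simp add: algebra_simps)

text \<open>On the curve \<open>S\<^sup>2 = poly N v\<close> every polynomial in \<open>v\<close>
  and \<open>S\<close> has this normal form. Asserting only its existence lets closure rules treat
  the Kippenhahn expression without expanding it.\<close>

definition quad_rep :: "complex poly \<Rightarrow> (complex \<Rightarrow> complex \<Rightarrow> complex) \<Rightarrow> bool" where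
  "quad_rep N F \<longleftrightarrow> (\<exists>U V. \<forall>v S. S\<^sup>2 = poly N v \<longrightarrow> F v S = poly U v + poly V v * S)"

lemma quad_repI: "(\<And>v S. S\<^sup>2 = poly N v \<Longrightarrow> F v S = poly U v + poly V v * S) \<Longrightarrow> quad_rep N F"
  unfolding quad_rep_def by blast

lemma quad_rep_poly: "quad_rep N (\<lambda>v S. poly p v)"
  by (rule quad_repI[of _ _ p 0]) simp

lemma quad_rep_root: "quad_rep N (\<lambda>v S. S)"
  by (rule quad_repI[of _ _ 0 1]) simp

lemma quad_rep_add: "quad_rep N F \<Longrightarrow> quad_rep N G \<Longrightarrow> quad_rep N (\<lambda>v S. F v S + G v S)"
  unfolding quad_rep_def
proof (elim exE)
  fix U V U' V'
  assume "\<forall>v S. S\<^sup>2 = poly N v \<longrightarrow> F v S = poly U v + poly V v * S"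
    "\<forall>v S. S\<^sup>2 = poly N v \<longrightarrow> G v S = poly U' v + poly V' v * S"
  then show "\<exists>U V. \<forall>v S. S\<^sup>2 = poly N v \<longrightarrow> F v S + G v S = poly U v + poly V v * S"
    by (intro exI[of _ "U + U'"] exI[of _ "V + V'"]) (simp add: algebra_simps)
qed

lemma quad_rep_mult: "quad_rep N F \<Longrightarrow> quad_rep N G \<Longrightarrow> quad_rep N (\<lambda>v S. F v S * G v S)"
  unfolding quad_rep_def
proof (elim exE)
  fix U V U' V'
  assume *: "\<forall>v S. S\<^sup>2 = poly N v \<longrightarrow> F v S = poly U v + poly V v * S"
    "\<forall>v S. S\<^sup>2 = poly N v \<longrightarrow> G v S = poly U' v + poly V' v * S"
  have "F v S * G v S = poly (U * U' + V * V' * N) v + poly (U * V' + V * U') v * S"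
    if "S\<^sup>2 = poly N v" for v S
    using * that by (simp add: algebra_simps power2_eq_square flip: that)
  then show "\<exists>U V. \<forall>v S. S\<^sup>2 = poly N v \<longrightarrow> F v S * G v S = poly U v + poly V v * S"
    by blast
qed

lemma quad_rep_diff:
  assumes "quad_rep N F" "quad_rep N G"
  shows "quad_rep N (\<lambda>v S. F v S - G v S)"
  using quad_rep_add[OF assms(1) quad_rep_mult[OF quad_rep_poly[of N "[:-1:]"] assms(2)]] by simp

lemma quad_rep_power: "quad_rep N F \<Longrightarrow> quad_rep N (\<lambda>v S. F v S ^ n)"
  using quad_rep_poly[of N 1] by (induction n) (auto intro: quad_rep_mult)

lemmas quad_rep_intros = quad_rep_root quad_rep_add quad_rep_diff quad_rep_mult quad_rep_power

text \<open>A polynomial with a simple root is not a square, so \<open>U\<^sup>2 = V\<^sup>2 * N\<close> forces \<open>U = V = 0\<close>;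
  hence both choices of the square root \<open>S\<close> of \<open>N\<close> annihilate \<open>F\<close>.\<close>

lemma quad_rep_eq_0:
  assumes F: "quad_rep N F" and r: "poly N r = 0" "poly (pderiv N) r \<noteq> 0"
    and inf: "infinite {v. \<exists>S. S\<^sup>2 = poly N v \<and> F v S = 0}"
    and S: "S\<^sup>2 = poly N v"
  shows "F v S = 0"
proof -
  obtain U V where UV: "\<And>v S. S\<^sup>2 = poly N v \<Longrightarrow> F v S = poly U v + poly V v * S"
    using F unfolding quad_rep_def by blast
  \<comment> \<open>The norm \<open>U\<^sup>2 - V\<^sup>2 * N\<close> of \<open>U + V * S\<close>
    vanishes at each such \<open>v\<close>.\<close>
  have "{v. \<exists>S. S\<^sup>2 = poly N v \<and> F v S = 0} \<subseteq> {v. poly (U\<^sup>2 - V\<^sup>2 * N) v = 0}"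
  proof clarify
    fix v S assume S: "S\<^sup>2 = poly N v" "F v S = 0"
    then have "poly U v = - (poly V v * S)" using UV[OF S(1)] by (simp add: eq_neg_iff_add_eq_0)
    then show "poly (U\<^sup>2 - V\<^sup>2 * N) v = 0" by (simp add: power_mult_distrib flip: S(1))
  qed
  then have "U\<^sup>2 - V\<^sup>2 * N = 0" using inf poly_roots_finite finite_subset by blast
  then have eq: "U\<^sup>2 = V\<^sup>2 * N" by simp
  have N: "N \<noteq> 0" using r by auto
  have "V = 0"
  proof (rule ccontr)
    assume V: "V \<noteq> 0"
    then have U: "U \<noteq> 0" using eq N by auto
    \<comment> \<open>The simple root makes the order of \<open>V\<^sup>2 * N\<close> at
      \<open>r\<close> odd, while that of \<open>U\<^sup>2\<close> is even.\<close>
    have "order r N = 1"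
    proof (rule order_unique_lemma)
      show "[:- r, 1:] ^ 1 dvd N" using r by (simp add: poly_eq_0_iff_dvd)
      show "\<not> [:- r, 1:] ^ Suc 1 dvd N"
      proof
        assume "[:- r, 1:] ^ Suc 1 dvd N"
        then obtain M where "N = [:- r, 1:]\<^sup>2 * M" by (auto simp: numeral_2_eq_2 elim: dvdE)
        moreover have "poly (pderiv (p\<^sup>2 * M)) r = 0" if "poly p r = 0" for p
          using that by (simp add: pderiv_mult power2_eq_square)
        ultimately show False using r(2) by simp
      qed
    qed
    moreover have "order r (U\<^sup>2) = 2 * order r U" using U by (simp add: order_mult power2_eq_square)
    moreover have "order r (V\<^sup>2 * N) = 2 * order r V + order r N"
      using V N by (simp add: order_mult power2_eq_square)
    ultimately have "2 * order r U = 2 * order r V + 1" using eq by simp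
    then show False by presburger
  qed
  moreover from this have "U = 0" using eq by simp
  ultimately show ?thesis using UV[OF S] by simp
qed

text \<open>The discriminant in \<open>l\<close> of the tangent equation, multiplied by
  \<open>v = cis (- 2 * \<theta>)\<close> to make it a polynomial in \<open>v\<close>.
  \<open>X\<close> is half the vector between the foci and \<open>B\<close> the squared minor
  half-axis.\<close>

definition tangent_disc :: "complex \<Rightarrow> real \<Rightarrow> complex poly" where
  "tangent_disc X B = [:X\<^sup>2, 2 * (X * cnj X) + of_real (4 * B), (cnj X)\<^sup>2:]"

lemma poly_tangent_disc: "poly (tangent_disc X B) v = (X + cnj X * v)\<^sup>2 + of_real (4 * B) * v"
  by (simp add: tangent_disc_def power2_eq_square algebra_simps)

text \<open>The linear coefficient is positive, so a root exists even for a circle, where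
  \<open>X = 0\<close>; a multiple root would force \<open>(cmod X)\<^sup>2 + B = 0\<close>.\<close>

lemma tangent_disc_simple_root:
  assumes "B > 0"
  obtains r where "poly (tangent_disc X B) r = 0" "poly (pderiv (tangent_disc X B)) r \<noteq> 0"
proof -
  let ?N = "tangent_disc X B"
  have XX: "X * cnj X = of_real ((cmod X)\<^sup>2)" by (metis complex_norm_square)
  have "coeff ?N 1 = of_real (2 * (cmod X)\<^sup>2 + 4 * B)" by (simp add: tangent_disc_def XX)
  moreover have "2 * (cmod X)\<^sup>2 + 4 * B \<noteq> 0" using assms by (smt (verit) zero_le_power2)
  ultimately have "coeff ?N 1 \<noteq> 0" by (metis of_real_eq_0_iff)
  then have "degree ?N \<noteq> 0" using le_degree by fastforce
  then have "\<not> constant (poly ?N)" by (simp add: constant_degree)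
  then obtain r where r: "poly ?N r = 0" using fundamental_theorem_of_algebra by blast
  have "poly (pderiv ?N) r \<noteq> 0"
  proof
    assume d: "poly (pderiv ?N) r = 0"
    define b Y where "b = complex_of_real B" and "Y = X + cnj X * r"
    have 1: "Y\<^sup>2 + 4 * b * r = 0" using r by (simp add: poly_tangent_disc b_def Y_def)
    have 2: "cnj X * Y + 2 * b = 0"
    proof -
      have "2 * (cnj X * Y + 2 * b) = 0"
        using d by (simp add: tangent_disc_def pderiv_pCons b_def Y_def power2_eq_square algebra_simps)
      then show ?thesis by (metis mult_eq_0_iff zero_neq_numeral)
    qed
    have "b * (b + (cnj X)\<^sup>2 * r) = 0" using 1 2 by Groebner_Basis.algebra
    then have "b + (cnj X)\<^sup>2 * r = 0" using assms by (simp add: b_def)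
    then have "X * cnj X + b = 0" using 2 unfolding Y_def by Groebner_Basis.algebra
    then have "of_real ((cmod X)\<^sup>2 + B) = (0::complex)" by (simp add: XX b_def)
    then have "(cmod X)\<^sup>2 + B = 0" by (metis of_real_eq_0_iff)
    then show False using assms by (smt (verit) zero_le_power2)
  qed
  with r that show thesis by blast
qed

text \<open>With \<open>v = cis (- 2 * \<theta>)\<close> and \<open>L = 2 * l * cis (- \<theta>)\<close> the condition
  \<open>(l - Re (cis \<theta> * f1)) * (l - Re (cis \<theta> * f2)) = B\<close> that the line \<open>Re (cis \<theta> * z) = l\<close> is tangent
  to the ellipse becomes polynomial in \<open>v\<close> and \<open>L\<close>, and so does the Kippenhahn equation. The value
  \<open>v = 0\<close>, not attained by real angles, corresponds to the lines through the foci.\<close>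

lemma tangent_lines_transfer:
  fixes f1 f2 :: complex and B :: real and a :: "nat \<Rightarrow> real"
  defines "tangent \<equiv> \<lambda>(\<theta> :: real) (l :: real). (l - Re (cis \<theta> * f1)) * (l - Re (cis \<theta> * f2)) = B"
    and "charroot \<equiv> \<lambda>(\<theta> :: real) (l :: real). l * rm7_sq (l\<^sup>2) (\<lambda>j. (cos \<theta>)\<^sup>2 + a j) = 0"
  assumes B: "B > 0"
    and inf: "infinite {cis (- 2 * \<theta>) | \<theta> l. tangent \<theta> l \<and> charroot \<theta> l}"
  shows "\<And>\<theta> l. tangent \<theta> l \<Longrightarrow> charroot \<theta> l"
    and "f1 * rm7_sq (f1\<^sup>2) (\<lambda>_. 1) = 0"
    and "f2 * rm7_sq (f2\<^sup>2) (\<lambda>_. 1) = 0"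
proof -
  define m X where "m = (f1 + f2) / 2" and "X = (f1 - f2) / 2"
  have f: "f1 = m + X" "f2 = m - X" by (auto simp: m_def X_def field_simps)
  define N where "N = tangent_disc X B"
  \<comment> \<open>The contribution of the centre plus a square root; the two choices of
    \<open>S\<close> are the two parallel tangents.\<close>
  define L where "L v S = poly [:m, cnj m:] v + S" for v S
  \<comment> \<open>At \<open>v = cis (- 2 * \<theta>)\<close> the weights are
    \<open>4 * v * ((cos \<theta>)\<^sup>2 + a j)\<close>, because
    \<open>(1 + v)\<^sup>2 = 4 * v * (cos \<theta>)\<^sup>2\<close>; homogeneity of
    \<open>rm7_sq\<close> takes out the factor \<open>4 * v\<close>.\<close>
  define F where "F v S = L v S * rm7_sq ((L v S)\<^sup>2) (\<lambda>j. poly ([:1, 1:]\<^sup>2 + [:0, of_real (4 * a j):]) v)" for v S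
  have "quad_rep N F"
    unfolding F_def L_def rm7_sq_def by (intro quad_rep_intros quad_rep_poly)
  have link: "\<exists>S. S\<^sup>2 = poly N (cis (- 2 * \<theta>)) \<and> (F (cis (- 2 * \<theta>)) S = 0 \<longleftrightarrow> charroot \<theta> l)"
    if "tangent \<theta> l" for \<theta> l
  proof -
    define w w' where "w = cis \<theta>" and "w' = cis (- \<theta>)"
    have ww: "w * w' = 1" by (simp add: w_def w'_def cis_mult)
    have w0: "w' \<noteq> 0" using ww by auto
    have v: "cis (- 2 * \<theta>) = w'\<^sup>2" by (simp add: w'_def Complex.DeMoivre)
    have w': "cnj w = w'" by (simp add: w_def w'_def cis_cnj)
    have Re2: "2 * of_real (Re (w * z)) = w * z + w' * cnj z" for z
      by (metis complex_add_cnj complex_cnj_mult of_real_mult of_real_numeral w')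
    define S where "S = w' * (2 * of_real l - 2 * of_real (Re (w * m)))"
    have "(l - Re (w * m) - Re (w * X)) * (l - Re (w * m) + Re (w * X)) = B"
      using that unfolding tangent_def f w_def by (simp add: algebra_simps)
    then have "(2 * l - 2 * Re (w * m))\<^sup>2 = (2 * Re (w * X))\<^sup>2 + 4 * B"
      by (simp add: power2_eq_square algebra_simps)
    then have "of_real ((2 * l - 2 * Re (w * m))\<^sup>2) = (of_real ((2 * Re (w * X))\<^sup>2 + 4 * B) :: complex)"
      by (rule arg_cong)
    then have "(2 * of_real l - 2 * of_real (Re (w * m)))\<^sup>2 = (2 * of_real (Re (w * X)))\<^sup>2 + (4 * of_real B :: complex)"
      by simp
    then have "S\<^sup>2 = w'\<^sup>2 * ((w * X + w' * cnj X)\<^sup>2 + 4 * of_real B)"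
      unfolding S_def Re2 power_mult_distrib by simp
    also have "\<dots> = poly N (w'\<^sup>2)"
      unfolding N_def poly_tangent_disc of_real_mult of_real_numeral using ww by Groebner_Basis.algebra
    finally have 1: "S\<^sup>2 = poly N (cis (- 2 * \<theta>))" unfolding v .
    have L: "L (w'\<^sup>2) S = 2 * w' * of_real l"
      unfolding L_def S_def Re2 using ww by (simp, Groebner_Basis.algebra)
    have cos: "2 * of_real (cos \<theta>) = w + w'"
      using Re2[of 1] by (simp add: w_def)
    have x: "poly ([:1, 1:]\<^sup>2 + [:0, of_real (4 * a j):]) (w'\<^sup>2) = 4 * w'\<^sup>2 * of_real ((cos \<theta>)\<^sup>2 + a j)" for j
    proof -
      have "4 * w'\<^sup>2 * of_real ((cos \<theta>)\<^sup>2 + a j) = w'\<^sup>2 * ((w + w')\<^sup>2 + 4 * of_real (a j))"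
        unfolding cos[symmetric] by (simp add: power2_eq_square algebra_simps)
      also have "\<dots> = poly ([:1, 1:]\<^sup>2 + [:0, of_real (4 * a j):]) (w'\<^sup>2)"
        using ww by (simp, Groebner_Basis.algebra)
      finally show ?thesis by simp
    qed
    have "F (w'\<^sup>2) S = 2 * w' * of_real l * rm7_sq (4 * w'\<^sup>2 * of_real (l\<^sup>2)) (\<lambda>j. 4 * w'\<^sup>2 * of_real ((cos \<theta>)\<^sup>2 + a j))"
      unfolding F_def L x by (simp add: power_mult_distrib)
    also have "\<dots> = 2 * w' * (4 * w'\<^sup>2) ^ 3 * of_real (l * rm7_sq (l\<^sup>2) (\<lambda>j. (cos \<theta>)\<^sup>2 + a j))"
      unfolding rm7_sq_homogeneous by (simp add: rm7_sq_def)
    finally have 2: "F (cis (- 2 * \<theta>)) S = 0 \<longleftrightarrow> charroot \<theta> l"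
      unfolding v charroot_def using w0 by (simp del: of_real_mult)
    show ?thesis using 1 2 by blast
  qed
  obtain r where r: "poly N r = 0" "poly (pderiv N) r \<noteq> 0"
    using tangent_disc_simple_root[OF B] unfolding N_def by blast
  have "{cis (- 2 * \<theta>) | \<theta> l. tangent \<theta> l \<and> charroot \<theta> l} \<subseteq> {v. \<exists>S. S\<^sup>2 = poly N v \<and> F v S = 0}"
    using link by blast
  then have inf': "infinite {v. \<exists>S. S\<^sup>2 = poly N v \<and> F v S = 0}"
    using inf finite_subset by blast
  note zero = quad_rep_eq_0[OF \<open>quad_rep N F\<close> r inf']
  show "charroot \<theta> l" if "tangent \<theta> l" for \<theta> l
    using link[OF that] zero by blast
  \<comment> \<open>At \<open>v = 0\<close> the discriminant is \<open>X\<^sup>2\<close>, so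
    \<open>L\<close> takes the values \<open>m + X\<close> and \<open>m - X\<close>, the foci, and
    all weights become 1.\<close>
  have "F 0 X = 0" "F 0 (- X) = 0"
    by (rule zero; simp add: N_def tangent_disc_def)+
  then show "f1 * rm7_sq (f1\<^sup>2) (\<lambda>_. 1) = 0" "f2 * rm7_sq (f2\<^sup>2) (\<lambda>_. 1) = 0"
    unfolding F_def L_def f by simp_all
qed

section \<open>Real foci and their signs\<close>

text \<open>In \<open>y = f\<^sup>2\<close> the cubic has the roots \<open>2\<close>,
  \<open>2 + sqrt 2\<close> and \<open>2 - sqrt 2\<close>, all nonnegative; the solutions
  \<open>f\<close> are the eigenvalues \<open>2 * cos (k * pi / 8)\<close> of the path.\<close>

lemma rm7_sq_path_root_real:
  fixes f :: complex
  assumes "f * rm7_sq (f\<^sup>2) (\<lambda>_. 1) = 0"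
  shows "f \<in> \<real>"
proof -
  have nonneg: "z \<in> \<real>" if "z\<^sup>2 = of_real c" "c \<ge> 0" for z :: complex and c
  proof -
    have "z\<^sup>2 = (of_real (sqrt c))\<^sup>2" using that by (simp flip: of_real_power)
    then have "z = of_real (sqrt c) \<or> z = - of_real (sqrt c)" by (simp add: power2_eq_iff)
    then show ?thesis by (metis Reals_of_real Reals_minus)
  qed
  define s where "s = complex_of_real (sqrt 2)"
  have s: "s\<^sup>2 = 2" unfolding s_def by (simp flip: of_real_power)
  have "rm7_sq y (\<lambda>_. 1) = y ^ 3 - 6 * y\<^sup>2 + 10 * y - 4" for y :: complex
    by (simp add: rm7_sq_def)
  moreover have "(y - 2) * ((y - (2 + s)) * (y - (2 - s))) = y ^ 3 - 6 * y\<^sup>2 + 10 * y - 4" for y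
  proof -
    have "(y - 2) * ((y - (2 + s)) * (y - (2 - s))) = (y - 2) * ((y - 2)\<^sup>2 - s\<^sup>2)"
      by (simp add: power2_eq_square algebra_simps)
    then show ?thesis unfolding s by (simp add: power2_eq_square power3_eq_cube algebra_simps)
  qed
  ultimately have "f * ((f\<^sup>2 - 2) * ((f\<^sup>2 - (2 + s)) * (f\<^sup>2 - (2 - s)))) = f * rm7_sq (f\<^sup>2) (\<lambda>_. 1)"
    by simp
  then have "f = 0 \<or> f\<^sup>2 = of_real 2 \<or> f\<^sup>2 = of_real (2 + sqrt 2) \<or> f\<^sup>2 = of_real (2 - sqrt 2)"
    using assms by (auto simp: s_def)
  moreover have "sqrt 2 \<le> 2" by (rule real_le_lsqrt) auto
  ultimately show ?thesis using nonneg[of f 2] nonneg[of f "2 + sqrt 2"] nonneg[of f "2 - sqrt 2"] by auto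
qed

text \<open>Here \<open>x\<close> stands for \<open>cos \<theta>\<close>, and \<open>rt\<close> says
  that all tangents of the ellipse with foci \<open>p\<close>, \<open>q\<close> belong to the
  family. The argument is Vieta's formula for the three roots of \<open>rm7_sq\<close>.\<close>

lemma foci_opposite_sign:
  fixes p q B :: real and a :: "nat \<Rightarrow> real"
  assumes B: "B > 0" and a: "\<And>j. a j \<ge> 0" and pq: "p + q \<noteq> 0"
    and rt: "\<And>x l. \<bar>x\<bar> \<le> 1 \<Longrightarrow> (l - x * p) * (l - x * q) = B \<Longrightarrow> l * rm7_sq (l\<^sup>2) (\<lambda>j. x\<^sup>2 + a j) = 0"
  shows "p * q < 0"
proof -
  define K d where "K = p * q" and "d = p + q"
  \<comment> \<open>The product of the three roots, that is, the sum over the matchings of size 3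
    with weights \<open>t + a j\<close>.\<close>
  define e where "e = [:a 0, 1:] * [:a 2, 1:] * [:a 4, 1:] + [:a 0, 1:] * [:a 2, 1:] * [:a 5, 1:]
    + [:a 0, 1:] * [:a 3, 1:] * [:a 5, 1:] + [:a 1, 1:] * [:a 3, 1:] * [:a 5, 1:]"
  have poly_e: "poly e t = (t + a 0) * (t + a 2) * (t + a 4) + (t + a 0) * (t + a 2) * (t + a 5)
    + (t + a 0) * (t + a 3) * (t + a 5) + (t + a 1) * (t + a 3) * (t + a 5)" for t
    unfolding e_def poly_add poly_mult by (simp add: add.commute)
  \<comment> \<open>The third root: the sum of all weights minus
    \<open>l1\<^sup>2 + l2\<^sup>2 = d\<^sup>2 * t - 2 * (K * t - B)\<close>.\<close>
  define h where "h = [:a 0 + a 1 + a 2 + a 3 + a 4 + a 5, 6:] - [:0, d\<^sup>2:] + [:- 2 * B, 2 * K:]"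
  \<comment> \<open>If \<open>K * t = B\<close>, one of the tangents passes through the origin, and
    \<open>l = 0\<close> satisfies the Kippenhahn equation without being a root of the cubic
    factor.\<close>
  have "poly (e - [:- B, K:]\<^sup>2 * h) t = 0" if t: "0 < t" "t < 1" and tK: "K * t \<noteq> B" for t
  proof -
    define x where "x = sqrt t"
    have x: "x\<^sup>2 = t" "x > 0" "x < 1" using t by (auto simp: x_def)
    define D where "D = sqrt ((p - q)\<^sup>2 * t + 4 * B)"
    have D0: "(p - q)\<^sup>2 * t + 4 * B > 0" using B t by (simp add: add_nonneg_pos)
    then have D: "D\<^sup>2 = (p - q)\<^sup>2 * x\<^sup>2 + 4 * B" "D > 0" by (auto simp: D_def x)
    define l1 l2 where "l1 = (d * x + D) / 2" and "l2 = (d * x - D) / 2"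
    have sum: "l1 + l2 = d * x" and prod: "l1 * l2 = K * t - B"
    proof -
      show "l1 + l2 = d * x" by (simp add: l1_def l2_def field_simps)
      have "2 * l1 = d * x + D" "2 * l2 = d * x - D" by (auto simp: l1_def l2_def)
      then have "4 * (l1 * l2) = (d * x)\<^sup>2 - D\<^sup>2" by Groebner_Basis.algebra
      also have "\<dots> = 4 * (K * t - B)" unfolding D K_def d_def x(1)[symmetric] by Groebner_Basis.algebra
      finally show "l1 * l2 = K * t - B" by simp
    qed
    have tangent: "(l - x * p) * (l - x * q) = B" if "l = l1 \<or> l = l2" for l
    proof -
      have "(l - l1) * (l - l2) = 0" using that by auto
      then have "l * l - (l1 + l2) * l + l1 * l2 = 0" by (simp add: algebra_simps)
      then show ?thesis unfolding sum prod d_def K_def x(1)[symmetric] by Groebner_Basis.algebra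
    qed
    have nz: "l1 \<noteq> 0" "l2 \<noteq> 0" using prod tK by auto
    \<comment> \<open>This is where \<open>p + q \<noteq> 0\<close> and \<open>x > 0\<close> enter:
      otherwise the tangents would be opposite and yield only one root of the cubic.\<close>
    have ne: "l1\<^sup>2 - l2\<^sup>2 \<noteq> 0"
    proof -
      have "l1\<^sup>2 - l2\<^sup>2 = (l1 + l2) * (l1 - l2)" by (simp add: power2_eq_square algebra_simps)
      also have "l1 - l2 = D" by (simp add: l1_def l2_def field_simps)
      finally show ?thesis using sum D x pq by (simp add: d_def)
    qed
    have r: "rm7_sq (l1\<^sup>2) (\<lambda>j. t + a j) = 0" "rm7_sq (l2\<^sup>2) (\<lambda>j. t + a j) = 0"
      using rt[OF _ tangent, of l1] rt[OF _ tangent, of l2] nz x by auto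
    define s1 s2 where "s1 = t + a 0 + (t + a 1) + (t + a 2) + (t + a 3) + (t + a 4) + (t + a 5)"
      and "s2 = (t + a 0) * (t + a 2 + (t + a 3) + (t + a 4) + (t + a 5)) + (t + a 1) * (t + a 3 + (t + a 4) + (t + a 5))
        + (t + a 2) * (t + a 4 + (t + a 5)) + (t + a 3) * (t + a 5)"
    define y1 y2 where "y1 = l1\<^sup>2" and "y2 = l2\<^sup>2"
    have s2: "rm7_sq y (\<lambda>j. t + a j) = y ^ 3 - s1 * y\<^sup>2 + s2 * y - poly e t" for y
      unfolding rm7_sq_def s1_def s2_def poly_e by (rule refl)
    \<comment> \<open>Elimination of \<open>s2\<close> from the two root equations.\<close>
    have "(y1 - y2) * (poly e t - y1 * y2 * (s1 - y1 - y2)) = 0"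
      using r unfolding s2 y1_def[symmetric] y2_def[symmetric] by Groebner_Basis.algebra
    then have "poly e t = y1 * y2 * (s1 - y1 - y2)" using ne by (simp add: y1_def y2_def)
    also have "y1 * y2 = (K * t - B)\<^sup>2" unfolding prod[symmetric] y1_def y2_def by Groebner_Basis.algebra
    also have "s1 - y1 - y2 = s1 - (d * x)\<^sup>2 + 2 * (K * t - B)"
      unfolding sum[symmetric] prod[symmetric] y1_def y2_def by Groebner_Basis.algebra
    also have "\<dots> = poly h t" unfolding h_def s1_def power_mult_distrib x
      by (simp add: algebra_simps)
    finally show ?thesis by (simp add: algebra_simps)
  qed
  moreover have "K * t \<noteq> B" if "t \<noteq> B / K" for t
    using that B by (cases "K = 0") (auto simp: field_simps)
  ultimately have "{0<..<1} - {B / K} \<subseteq> {t. poly (e - [:- B, K:]\<^sup>2 * h) t = 0}"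
    by auto
  moreover have "infinite ({0<..<1} - {B / K})" by simp
  ultimately have "e - [:- B, K:]\<^sup>2 * h = 0" using poly_roots_finite finite_subset by blast
  then have e: "poly e t = (K * t - B)\<^sup>2 * poly h t" for t
    by (simp add: algebra_simps)
  have "K \<noteq> 0"
  proof
    assume "K = 0"
    then have eq: "poly e t = B\<^sup>2 * poly h t" for t using e[of t] by simp
    \<comment> \<open>The third difference is 6 times the cubic coefficient: that of
      \<open>e\<close> is 4, whereas \<open>h\<close> is at most linear.\<close>
    have "poly e 3 - 3 * poly e 2 + 3 * poly e 1 - poly e 0 = 24"
      unfolding poly_e by (simp add: algebra_simps)
    moreover have "poly h 3 - 3 * poly h 2 + 3 * poly h 1 - poly h 0 = 0"
      unfolding h_def by (simp add: algebra_simps)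
    moreover have "poly e 3 - 3 * poly e 2 + 3 * poly e 1 - poly e 0
        = B\<^sup>2 * (poly h 3 - 3 * poly h 2 + 3 * poly h 1 - poly h 0)"
      unfolding eq by (simp add: algebra_simps)
    ultimately show False by simp
  qed
  moreover have "\<not> K > 0"
  proof
    assume K: "K > 0"
    \<comment> \<open>A zero of the square factor, positive exactly because \<open>K\<close>
      is.\<close>
    define t where "t = B / K"
    have "t > 0" using K B by (simp add: t_def)
    then have "t + a j > 0" for j using a[of j] by linarith
    then have "poly e t > 0"
      unfolding poly_e by (simp add: add_pos_pos)
    moreover have "poly e t = 0" using e[of t] K by (simp add: t_def)
    ultimately show False by simp
  qed
  ultimately show ?thesis unfolding K_def by linarith
qed

section \<open>Tangent lines of an ellipse and the envelope\<close>

text \<open>With \<open>c\<close> half the distance of the foci, \<open>z\<close> has distances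
  \<open>a - c * cos \<phi>\<close> and \<open>a + c * cos \<phi>\<close> from them. The premise of
  the last claim says that the derivative of the middle formula in \<open>\<phi>\<close> vanishes,
  so the line is tangent at \<open>z\<close>; the signed distances of the foci from a tangent have
  product \<open>b\<^sup>2\<close>.\<close>

lemma ellipse_parametrization:
  fixes f1 f2 :: complex and s \<phi> :: real
  defines "a \<equiv> s / 2" and "b \<equiv> sqrt (s\<^sup>2 - (dist f1 f2)\<^sup>2) / 2"
    and "m \<equiv> (f1 + f2) / 2" and "\<psi> \<equiv> Arg (f1 - f2)"
  defines "z \<equiv> m + cis \<psi> * Complex (a * cos \<phi>) (b * sin \<phi>)"
  assumes s: "dist f1 f2 < s"
  shows "z \<in> ellipse f1 f2 s"
    and "Re (cis \<theta> * z) = Re (cis \<theta> * m) + a * cos (\<theta> + \<psi>) * cos \<phi> - b * sin (\<theta> + \<psi>) * sin \<phi>"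
    and "a * cos (\<theta> + \<psi>) * sin \<phi> + b * sin (\<theta> + \<psi>) * cos \<phi> = 0 \<Longrightarrow>
      (Re (cis \<theta> * z) - Re (cis \<theta> * f1)) * (Re (cis \<theta> * z) - Re (cis \<theta> * f2)) = b\<^sup>2"
proof -
  define c where "c = dist f1 f2 / 2"
  have c: "0 \<le> c" "c < a" using s by (auto simp: c_def a_def)
  have "(dist f1 f2)\<^sup>2 \<le> s\<^sup>2" using s by (intro power_mono) auto
  then have "b\<^sup>2 = (s\<^sup>2 - (dist f1 f2)\<^sup>2) / 4" unfolding b_def by (simp add: power_divide)
  then have b2: "b\<^sup>2 = a\<^sup>2 - c\<^sup>2" by (simp add: a_def c_def power_divide diff_divide_distrib)
  \<comment> \<open>For a circle both sides vanish, whatever the angle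
    \<open>\<psi>\<close>.\<close>
  have "cis \<psi> * of_real (cmod (f1 - f2)) = f1 - f2"
    unfolding \<psi>_def by (metis rcis_cmod_Arg rcis_def mult.commute)
  then have "cis \<psi> * of_real c = (f1 - f2) / 2" by (simp add: c_def dist_norm)
  then have f: "f1 = m + cis \<psi> * of_real c" "f2 = m - cis \<psi> * of_real c"
    by (auto simp: m_def field_simps)
  have focal: "cmod (Complex (a * cos \<phi> + k) (b * sin \<phi>)) = a + k * cos \<phi>" if k: "k = c \<or> k = - c" for k
  proof -
    have kb: "b\<^sup>2 = a\<^sup>2 - k\<^sup>2" using k b2 by auto
    have sc: "(sin \<phi>)\<^sup>2 = 1 - (cos \<phi>)\<^sup>2" using sin_squared_eq by blast
    have "(a * cos \<phi> + k)\<^sup>2 + (b * sin \<phi>)\<^sup>2 = (a + k * cos \<phi>)\<^sup>2"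
      unfolding power_mult_distrib[of b] kb sc by (simp add: power2_eq_square algebra_simps)
    moreover have "\<bar>k * cos \<phi>\<bar> \<le> c * 1" unfolding abs_mult using k c by (intro mult_mono) auto
    then have "a + k * cos \<phi> \<ge> 0" using c by linarith
    ultimately show ?thesis by (simp add: cmod_def)
  qed
  have "z - f1 = cis \<psi> * Complex (a * cos \<phi> + - c) (b * sin \<phi>)"
    "z - f2 = cis \<psi> * Complex (a * cos \<phi> + c) (b * sin \<phi>)"
    unfolding z_def f by (simp_all add: complex_eq_iff algebra_simps)
  then have "dist z f1 = a + - c * cos \<phi>" "dist z f2 = a + c * cos \<phi>"
    using focal[of "- c"] focal[of c] by (simp_all add: dist_norm norm_mult)
  then show "z \<in> ellipse f1 f2 s" by (simp add: ellipse_def a_def)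
  have Re_cis: "Re (cis \<theta> * (cis \<psi> * w)) = cos (\<theta> + \<psi>) * Re w - sin (\<theta> + \<psi>) * Im w" for w
    by (simp add: mult.assoc[symmetric] cis_mult)
  show z: "Re (cis \<theta> * z) = Re (cis \<theta> * m) + a * cos (\<theta> + \<psi>) * cos \<phi> - b * sin (\<theta> + \<psi>) * sin \<phi>"
    unfolding z_def distrib_left plus_complex.sel Re_cis by simp
  assume t: "a * cos (\<theta> + \<psi>) * sin \<phi> + b * sin (\<theta> + \<psi>) * cos \<phi> = 0"
  define p q where "p = a * cos (\<theta> + \<psi>)" and "q = b * sin (\<theta> + \<psi>)"
  have 1: "Re (cis \<theta> * f1) = Re (cis \<theta> * m) + c * cos (\<theta> + \<psi>)"
    "Re (cis \<theta> * f2) = Re (cis \<theta> * m) - c * cos (\<theta> + \<psi>)"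
    unfolding f distrib_left right_diff_distrib plus_complex.sel minus_complex.sel Re_cis by simp_all
  have "(Re (cis \<theta> * z) - Re (cis \<theta> * f1)) * (Re (cis \<theta> * z) - Re (cis \<theta> * f2))
    = (p * cos \<phi> - q * sin \<phi>)\<^sup>2 - c\<^sup>2 * (cos (\<theta> + \<psi>))\<^sup>2"
    unfolding z 1 p_def q_def by (simp add: power2_eq_square algebra_simps)
  \<comment> \<open>Lagrange's identity; tangency annihilates the last square.\<close>
  also have "(p * cos \<phi> - q * sin \<phi>)\<^sup>2 = (p\<^sup>2 + q\<^sup>2) * ((sin \<phi>)\<^sup>2 + (cos \<phi>)\<^sup>2) - (p * sin \<phi> + q * cos \<phi>)\<^sup>2"
    by Groebner_Basis.algebra
  also have "\<dots> = p\<^sup>2 + q\<^sup>2" using t by (simp add: p_def q_def)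
  also have "p\<^sup>2 + q\<^sup>2 = a\<^sup>2 * (cos (\<theta> + \<psi>))\<^sup>2 + b\<^sup>2 * (1 - (cos (\<theta> + \<psi>))\<^sup>2)"
    unfolding p_def q_def power_mult_distrib by (simp add: sin_squared_eq)
  also have "\<dots> - c\<^sup>2 * (cos (\<theta> + \<psi>))\<^sup>2 = b\<^sup>2"
    unfolding b2 by (simp add: algebra_simps)
  finally show "(Re (cis \<theta> * z) - Re (cis \<theta> * f1)) * (Re (cis \<theta> * z) - Re (cis \<theta> * f2)) = b\<^sup>2" .
qed

text \<open>\<open>cis (- 2 * \<theta>)\<close> determines \<open>\<theta>\<close> modulo
  \<open>pi\<close>, hence \<open>tan (\<theta> + \<psi>)\<close>, and tangency makes
  \<open>tan \<phi>\<close> a fixed multiple of it. One open quadrant is taken because opposite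
  points of the ellipse have parallel tangents.\<close>

lemma tangent_direction_inj:
  fixes a b \<psi> \<theta> \<theta>' \<phi> \<phi>' :: real
  assumes ab: "a > 0" "b > 0"
    and \<phi>: "\<phi> \<in> {0<..<pi / 2}" "\<phi>' \<in> {0<..<pi / 2}"
    and t: "a * cos (\<theta> + \<psi>) * sin \<phi> + b * sin (\<theta> + \<psi>) * cos \<phi> = 0"
    and t': "a * cos (\<theta>' + \<psi>) * sin \<phi>' + b * sin (\<theta>' + \<psi>) * cos \<phi>' = 0"
    and cis: "cis (- 2 * \<theta>) = cis (- 2 * \<theta>')"
  shows "\<phi> = \<phi>'"
proof -
  have nz: "cos (x + \<psi>) \<noteq> 0"
    if "a * cos (x + \<psi>) * sin y + b * sin (x + \<psi>) * cos y = 0" "y \<in> {0<..<pi / 2}" for x y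
  proof
    assume 0: "cos (x + \<psi>) = 0"
    have "cos y > 0" using that(2) by (intro cos_gt_zero) auto
    then have "sin (x + \<psi>) = 0" using 0 that ab by auto
    then show False using 0 sin_cos_squared_add[of "x + \<psi>"] by simp
  qed
  have "cos (2 * \<theta>) = cos (2 * \<theta>')" "sin (2 * \<theta>) = sin (2 * \<theta>')"
    using cis by (auto simp: complex_eq_iff)
  then have "cos (2 * \<theta> - 2 * \<theta>') = 1" unfolding cos_diff by (metis power2_eq_square sin_cos_squared_add2)
  then have "cos (2 * (\<theta> - \<theta>')) = 1" by (simp add: algebra_simps)
  then have "sin ((\<theta> + \<psi>) - (\<theta>' + \<psi>)) = 0" unfolding cos_double_sin by simp
  then have d: "sin (\<theta> + \<psi>) * cos (\<theta>' + \<psi>) = cos (\<theta> + \<psi>) * sin (\<theta>' + \<psi>)" unfolding sin_diff by simp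
  have "a * cos (\<theta> + \<psi>) * cos (\<theta>' + \<psi>) * (sin \<phi> * cos \<phi>' - cos \<phi> * sin \<phi>') = 0"
    using t t' d by Groebner_Basis.algebra
  then have 0: "sin (\<phi> - \<phi>') = 0" using nz[OF t \<phi>(1)] nz[OF t' \<phi>(2)] ab by (simp add: sin_diff)
  then have "sin (\<phi>' - \<phi>) = 0" using sin_minus[of "\<phi> - \<phi>'"] by simp
  then show ?thesis
    using 0 sin_gt_zero[of "\<phi> - \<phi>'"] sin_gt_zero[of "\<phi>' - \<phi>"] \<phi> pi_gt_zero
    by (cases \<phi> \<phi>' rule: linorder_cases) auto
qed

text \<open>Every point of the ellipse is a contact point of some branch, and the parameters with a
  transversal contact are negligible. The parameters left in a quadrant are infinitely many and give
  distinct tangent directions.\<close>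

lemma infinite_tangents_if_ellipse_subset_envelope:
  fixes R :: "real \<Rightarrow> real set"
  assumes R: "\<And>t. finite (R t)" "\<And>t. card (R t) \<le> M"
    and s: "dist f1 f2 < s" and sub: "ellipse f1 f2 s \<subseteq> line_envelope R"
  shows "infinite {cis (- 2 * \<theta>) | \<theta> l.
    (l - Re (cis \<theta> * f1)) * (l - Re (cis \<theta> * f2)) = (s\<^sup>2 - (dist f1 f2)\<^sup>2) / 4 \<and> l \<in> R \<theta>}"
    (is "infinite ?T")
proof -
  define a b m \<psi> where "a = s / 2" and "b = sqrt (s\<^sup>2 - (dist f1 f2)\<^sup>2) / 2"
    and "m = (f1 + f2) / 2" and "\<psi> = Arg (f1 - f2)"
  define z where "z \<phi> = m + cis \<psi> * Complex (a * cos \<phi>) (b * sin \<phi>)" for \<phi>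
  note param = ellipse_parametrization[OF s, folded a_def b_def m_def \<psi>_def, folded z_def]
  have "(dist f1 f2)\<^sup>2 < s\<^sup>2" using s by (intro power_strict_mono) auto
  then have b: "b > 0" "b\<^sup>2 = (s\<^sup>2 - (dist f1 f2)\<^sup>2) / 4" by (simp_all add: b_def power_divide)
  have a: "a > 0" using s zero_le_dist[of f1 f2] unfolding a_def by linarith
  define g where "g \<theta> \<phi> = Re (cis \<theta> * m) + a * cos (\<theta> + \<psi>) * cos \<phi> - b * sin (\<theta> + \<psi>) * sin \<phi>" for \<theta> \<phi>
  define g' where "g' \<theta> \<phi> = - (a * cos (\<theta> + \<psi>) * sin \<phi> + b * sin (\<theta> + \<psi>) * cos \<phi>)" for \<theta> \<phi>
  have g: "Re (cis \<theta> * z \<phi>) = g \<theta> \<phi>" for \<theta> \<phi> using param(2) by (simp add: g_def)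
  define S where "S = {\<phi>. \<exists>\<theta> \<mu>. (\<forall>\<^sub>F t in nhds \<theta>. \<mu> t \<in> R t) \<and> g \<theta> \<phi> = \<mu> \<theta> \<and>
    ((\<lambda>t. g t \<phi> - \<mu> t) has_real_derivative 0) (at \<theta>) \<and> g' \<theta> \<phi> \<noteq> 0}"
  have "negligible S"
    unfolding S_def
  proof (rule negligible_transversal_contacts[OF R])
    show "(g \<theta> has_real_derivative g' \<theta> \<phi>) (at \<phi>)" for \<theta> \<phi>
      unfolding g_def g'_def by (auto intro!: derivative_eq_intros)
    show "continuous_on UNIV (\<lambda>(\<theta>, \<phi>). g' \<theta> \<phi>)"
      unfolding g'_def case_prod_unfold by (intro continuous_intros)
  qed
  define G where "G = {0<..<pi / 2} - S"
  have "infinite G"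
  proof
    assume "finite G"
    then have "negligible (G \<union> S)" using \<open>negligible S\<close> negligible_Un negligible_finite by blast
    then have "negligible {0<..<pi / 2}" by (rule negligible_subset) (auto simp: G_def)
    moreover have "{0<..<pi / 2} \<noteq> {}" using pi_gt_zero by (simp add: not_le)
    ultimately show False using open_not_negligible[OF open_greaterThanLessThan] by blast
  qed
  have "\<exists>\<theta>. g' \<theta> \<phi> = 0 \<and> g \<theta> \<phi> \<in> R \<theta>" if "\<phi> \<in> G" for \<phi>
  proof -
    have "z \<phi> \<in> line_envelope R" using param(1) sub by blast
    then obtain \<theta> \<mu> where \<mu>: "\<forall>\<^sub>F t in nhds \<theta>. \<mu> t \<in> R t" "g \<theta> \<phi> = \<mu> \<theta>"
      "((\<lambda>t. g t \<phi> - \<mu> t) has_real_derivative 0) (at \<theta>)"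
      unfolding line_envelope_def mem_rotated_line_iff mem_Collect_eq g by blast
    then have "g' \<theta> \<phi> = 0" using that unfolding G_def S_def by blast
    moreover have "\<mu> \<theta> \<in> R \<theta>" using \<mu>(1) by (rule eventually_nhds_x_imp_x)
    ultimately show ?thesis using \<mu>(2) by auto
  qed
  then obtain \<Theta> where \<Theta>: "\<And>\<phi>. \<phi> \<in> G \<Longrightarrow> g' (\<Theta> \<phi>) \<phi> = 0" "\<And>\<phi>. \<phi> \<in> G \<Longrightarrow> g (\<Theta> \<phi>) \<phi> \<in> R (\<Theta> \<phi>)"
    by metis
  have inj: "inj_on (\<lambda>\<phi>. cis (- 2 * \<Theta> \<phi>)) G"
  proof (rule inj_onI)
    fix \<phi> \<phi>' assume *: "\<phi> \<in> G" "\<phi>' \<in> G" "cis (- 2 * \<Theta> \<phi>) = cis (- 2 * \<Theta> \<phi>')"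
    show "\<phi> = \<phi>'"
      by (rule tangent_direction_inj[OF a b(1) _ _ _ _ *(3), of _ _ \<psi>])
        (use *(1,2) \<Theta>(1) in \<open>auto simp: G_def g'_def add_eq_0_iff\<close>)
  qed
  have "(\<lambda>\<phi>. cis (- 2 * \<Theta> \<phi>)) ` G \<subseteq> ?T"
  proof clarify
    fix \<phi> assume "\<phi> \<in> G"
    from \<Theta>[OF this] show "\<exists>\<theta> l. cis (- 2 * \<Theta> \<phi>) = cis (- 2 * \<theta>) \<and>
      (l - Re (cis \<theta> * f1)) * (l - Re (cis \<theta> * f2)) = (s\<^sup>2 - (dist f1 f2)\<^sup>2) / 4 \<and> l \<in> R \<theta>"
      using param(3)[of "\<Theta> \<phi>" \<phi>] unfolding g b(2) g'_def
      by (intro exI[of _ "\<Theta> \<phi>"] exI[of _ "g (\<Theta> \<phi>) \<phi>"]) simp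
  qed
  then show ?thesis using \<open>infinite G\<close> inj finite_imageD finite_subset by blast
qed

section \<open>Application to the Kippenhahn curve\<close>

text \<open>For real \<open>l\<close> the equation is a real polynomial equation of degree 7; this
  supplies the finiteness and the uniform bound required of the family of lines.\<close>

lemma kippenhahn_roots_rm7:
  assumes "A \<in> reciprocal_mats 7"
  defines "R \<equiv> \<lambda>\<theta>. {l. kippenhahn_poly A (complex_of_real l) \<theta> = 0}"
  shows "l \<in> R \<theta> \<longleftrightarrow> l * rm7_sq (l\<^sup>2) (\<lambda>j. (cos \<theta>)\<^sup>2 + coupling A j) = 0"
    and "finite (R \<theta>)" and "card (R \<theta>) \<le> 7"
proof -
  let ?x = "\<lambda>j. (cos \<theta>)\<^sup>2 + coupling A j"
  have eq: "kippenhahn_poly A (of_real l) \<theta> = of_real (- (l * rm7_sq (l\<^sup>2) ?x))" for l :: real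
    unfolding kippenhahn_poly_rm7[OF assms(1)] by (simp add: rm7_sq_def)
  have R: "l \<in> R \<theta> \<longleftrightarrow> l * rm7_sq (l\<^sup>2) ?x = 0" for l
    unfolding R_def mem_Collect_eq eq of_real_eq_0_iff neg_equal_0_iff_equal by (rule refl)
  then show "l \<in> R \<theta> \<longleftrightarrow> l * rm7_sq (l\<^sup>2) ?x = 0" .
  obtain c1 c2 c3 where c: "\<And>y. rm7_sq y ?x = y ^ 3 - c1 * y\<^sup>2 + c2 * y - c3"
    unfolding rm7_sq_def by blast
  define p where "p = [:0, - c3, 0, c2, 0, - c1, 0, 1:]"
  have p: "R \<theta> = {l. poly p l = 0}"
    unfolding set_eq_iff R c p_def by (simp add: power2_eq_square power3_eq_cube algebra_simps)
  have "p \<noteq> 0" "degree p \<le> 7" by (simp_all add: p_def)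
  then show "finite (R \<theta>)" "card (R \<theta>) \<le> 7"
    unfolding p using poly_roots_finite card_poly_roots_bound order_trans by blast+
qed

theorem theorem7:
  fixes A :: "complex mat" and E :: "complex set" and f1 f2 :: complex and s :: real
  assumes "A \<in> reciprocal_mats 7"
    and "dist f1 f2 < s"
    and "E = ellipse f1 f2 s"
    and "E \<noteq> uminus ` E"
    and "E \<union> uminus ` E \<subseteq> kippenhahn_curve A"
  shows "f1 \<in> \<real> \<and> f2 \<in> \<real> \<and> Re f1 * Re f2 < 0"
proof -
  define B where "B = (s\<^sup>2 - (dist f1 f2)\<^sup>2) / 4"
  have "(dist f1 f2)\<^sup>2 < s\<^sup>2" using assms(2) by (intro power_strict_mono) auto
  then have B: "B > 0" by (simp add: B_def)
  note roots = kippenhahn_roots_rm7[OF assms(1)]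
  have "ellipse f1 f2 s \<subseteq> line_envelope (\<lambda>\<theta>. {l. kippenhahn_poly A (of_real l) \<theta> = 0})"
    using assms(3,5) unfolding kippenhahn_curve_def by blast
  note inf = infinite_tangents_if_ellipse_subset_envelope[OF roots(2,3) assms(2) this, folded B_def, unfolded roots(1)]
  note transfer = tangent_lines_transfer[OF B inf]
  have real: "f1 \<in> \<real>" "f2 \<in> \<real>"
    using transfer(2,3) rm7_sq_path_root_real by blast+
  define p q where "p = Re f1" and "q = Re f2"
  have f: "f1 = of_real p" "f2 = of_real q" using real by (simp_all add: p_def q_def)
  \<comment> \<open>Otherwise the foci are opposite, and negation exchanges the two focal distances,
    so \<open>E\<close> equals its own reflection.\<close>
  have "p + q \<noteq> 0"
  proof
    assume "p + q = 0"
    then have f2: "f2 = - f1" by (simp add: f add_eq_0_iff2 flip: of_real_minus)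
    have "dist (- z) f1 = dist z f2" "dist (- z) f2 = dist z f1" for z
      unfolding f2 dist_norm by (metis minus_diff_eq norm_minus_cancel diff_minus_eq_add add.commute uminus_add_conv_diff)+
    then have neg: "- z \<in> E" if "z \<in> E" for z
      using that by (simp add: assms(3) ellipse_def add.commute)
    have "z \<in> uminus ` E" if "z \<in> E" for z
      using imageI[OF neg[OF that], of uminus] by simp
    then have "E = uminus ` E" using neg by blast
    then show False using assms(4) by simp
  qed
  \<comment> \<open>For real foci \<open>Re (cis \<theta> * f1)\<close> is
    \<open>cos \<theta> * p\<close>; the angle \<open>arccos x\<close> realizes the given
    \<open>x\<close>.\<close>
  moreover have "l * rm7_sq (l\<^sup>2) (\<lambda>j. x\<^sup>2 + coupling A j) = 0"
    if "\<bar>x\<bar> \<le> 1" "(l - x * p) * (l - x * q) = B" for x l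
    using transfer(1)[of l "arccos x"] that by (simp add: f abs_le_iff)
  ultimately have "p * q < 0" by (rule foci_opposite_sign[where a = "coupling A", OF B coupling_nonneg])
  then show ?thesis using real by (simp add: p_def q_def)
qed

end
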